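(* For every connected open set $\mathcal{O}\subset\mathbb{R}^3$ and every smooth function $f=f(x,y)$ on $\mathcal{O}$, the Lorentzian manifold $\mathcal{M}_f=(\mathcal{O},g_f)$ is a VSI manifold.
   Context: Let $(x,y,\tilde x)$ be the coordinates on $\mathbb{R}^3$. $\mathcal{M}_f=(\mathcal{O},g_f)$ is the $3$-dimensional Lorentzian (Walker) manifold whose only (possibly) non-zero metric components are $$g_f(\partial_x,\partial_x)=-2f(x,y),\quad g_f(\partial_x,\partial_{\tilde x})=g_f(\partial_y,\partial_y)=1,$$ where $f$ depends only on $(x,y)$. A pseudo-Riemannian manifold is VSI (vanishing scalar invariants) if all scalar Weyl invariants vanish identically, where a scalar Weyl invariant is a scalar constructed from the curvature tensor and its covariant derivatives by contracting indices in pairs using the metric. *)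

theory Defs
  imports "HOL-Analysis.Analysis"
begin

text \<open>
  Pseudo-Riemannian geometry on a set of \<open>\<real>\<^sup>n\<close> (used only for open sets) in the global
  coordinate frame. The library has no notion of \<open>C\<^sup>\<infinity>\<close> function of several variables; on an open
  set, \<open>C\<^sup>\<infinity>\<close> means that all iterated partial derivatives exist and are differentiable.
\<close>

definition partial :: "'n::finite \<Rightarrow> (real ^ 'n \<Rightarrow> real) \<Rightarrow> real ^ 'n \<Rightarrow> real" where
  "partial i f p = frechet_derivative f (at p) (axis i 1)"

definition smooth_on :: "(real ^ 'n::finite) set \<Rightarrow> (real ^ 'n \<Rightarrow> real) \<Rightarrow> bool" where
  "smooth_on U f \<longleftrightarrow> (\<forall>js. \<forall>p\<in>U. fold partial js f differentiable (at p))"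

type_synonym 'n metric_field = "real ^ 'n \<Rightarrow> real ^ 'n ^ 'n"

definition pseudo_riemannian_on :: "(real ^ 'n::finite) set \<Rightarrow> 'n metric_field \<Rightarrow> bool" where
  "pseudo_riemannian_on U g \<longleftrightarrow>
     (\<forall>i j. smooth_on U (\<lambda>p. g p $ i $ j)) \<and>
     (\<forall>p\<in>U. transpose (g p) = g p \<and> invertible (g p))"

text \<open>Signature \<open>(1, n - 1)\<close>: at each point there is a pseudo-orthonormal frame \<open>e\<close> with exactly
  one timelike vector \<open>e i0\<close>.\<close>

definition lorentzian_on :: "(real ^ 'n::finite) set \<Rightarrow> 'n metric_field \<Rightarrow> bool" where
  "lorentzian_on U g \<longleftrightarrow> pseudo_riemannian_on U g \<and>
     (\<forall>p\<in>U. \<exists>(e :: 'n \<Rightarrow> real ^ 'n) i0. \<forall>i j.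
        e i \<bullet> (g p *v e j) = (if i \<noteq> j then 0 else if i = i0 then - 1 else 1))"

text \<open>\<open>christoffel g l i j\<close> is \<open>\<Gamma>\<close> with upper index \<open>l\<close> and lower indices \<open>i\<close>, \<open>j\<close>, for the
  Levi-Civita connection of \<open>g\<close>.\<close>

definition christoffel ::
    "'n::finite metric_field \<Rightarrow> 'n \<Rightarrow> 'n \<Rightarrow> 'n \<Rightarrow> real ^ 'n \<Rightarrow> real" where
  "christoffel g l i j p = (\<Sum>m\<in>UNIV. matrix_inv (g p) $ l $ m *
     (partial i (\<lambda>q. g q $ j $ m) p + partial j (\<lambda>q. g q $ i $ m) p
      - partial m (\<lambda>q. g q $ i $ j) p)) / 2"

text \<open>The components of the \<open>(1,3)\<close> curvature, with
  \<open>R(\<partial>\<^sub>i,\<partial>\<^sub>j)\<partial>\<^sub>k = (\<nabla>\<^sub>i\<nabla>\<^sub>j - \<nabla>\<^sub>j\<nabla>\<^sub>i)\<partial>\<^sub>k = \<Sum>\<^sub>l (curvature_op g i j k l) \<partial>\<^sub>l\<close>.\<close>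

definition curvature_op ::
    "'n::finite metric_field \<Rightarrow> 'n \<Rightarrow> 'n \<Rightarrow> 'n \<Rightarrow> 'n \<Rightarrow> real ^ 'n \<Rightarrow> real" where
  "curvature_op g i j k l p =
     partial i (christoffel g l j k) p - partial j (christoffel g l i k) p
     + (\<Sum>m\<in>UNIV. christoffel g l i m p * christoffel g m j k p
               - christoffel g l j m p * christoffel g m i k p)"

text \<open>A covariant \<open>r\<close>-tensor field is given by its components \<open>T is\<close>, where \<open>is\<close> ranges over
  index lists of length \<open>r\<close>; values at other lists are junk.\<close>

type_synonym 'n tensor_field = "'n list \<Rightarrow> real ^ 'n \<Rightarrow> real"

definition curvature :: "'n::finite metric_field \<Rightarrow> 'n tensor_field" where
  "curvature g is p =
     (\<Sum>m\<in>UNIV. curvature_op g (is ! 0) (is ! 1) (is ! 2) m p * g p $ m $ (is ! 3))"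

text \<open>The direction of differentiation is the last index of \<open>cov_deriv g T\<close>.\<close>

definition cov_deriv :: "'n::finite metric_field \<Rightarrow> 'n tensor_field \<Rightarrow> 'n tensor_field" where
  "cov_deriv g T is p = (let js = butlast is; m = last is in
     partial m (T js) p
     - (\<Sum>a<length js. \<Sum>l\<in>UNIV. christoffel g l m (js ! a) p * T (js[a := l]) p))"

definition nabla_curvature :: "'n::finite metric_field \<Rightarrow> nat \<Rightarrow> 'n tensor_field" where
  "nabla_curvature g k = (cov_deriv g ^^ k) (curvature g)"

text \<open>The tensor product \<open>\<nabla>\<^sup>k\<^sup>1R \<otimes> \<dots> \<otimes> \<nabla>\<^sup>k\<^sup>sR\<close> for a list \<open>[k1, \<dots>, ks]\<close> and its number of
  indices.\<close>

primrec curvature_product :: "'n::finite metric_field \<Rightarrow> nat list \<Rightarrow> 'n tensor_field" where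
  "curvature_product g [] is p = 1"
| "curvature_product g (k # ks) is p =
     nabla_curvature g k (take (4 + k) is) p * curvature_product g ks (drop (4 + k) is) p"

definition product_rank :: "nat list \<Rightarrow> nat" where
  "product_rank ks = (\<Sum>k\<leftarrow>ks. 4 + k)"

text \<open>A complete pairing of the index positions \<open>0, \<dots>, r - 1\<close>: each position occurs in exactly
  one pair, exactly once.\<close>

definition complete_pairing :: "nat \<Rightarrow> (nat \<times> nat) list \<Rightarrow> bool" where
  "complete_pairing r ps \<longleftrightarrow>
     distinct (map fst ps @ map snd ps) \<and> set (map fst ps @ map snd ps) = {..<r}"

definition contract ::
    "'n::finite metric_field \<Rightarrow> nat \<Rightarrow> (nat \<times> nat) list \<Rightarrow> 'n tensor_field \<Rightarrow> real ^ 'n \<Rightarrow> real" where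
  "contract g r ps T p = (\<Sum>is | length is = r.
     (\<Prod>(a, b)\<leftarrow>ps. matrix_inv (g p) $ (is ! a) $ (is ! b)) * T is p)"

text \<open>The empty product is excluded: its contraction is the constant 1.\<close>

definition scalar_weyl_invariants :: "'n::finite metric_field \<Rightarrow> (real ^ 'n \<Rightarrow> real) set" where
  "scalar_weyl_invariants g =
     {contract g (product_rank ks) ps (curvature_product g ks) | ks ps.
        ks \<noteq> [] \<and> complete_pairing (product_rank ks) ps}"

definition VSI_on :: "(real ^ 'n::finite) set \<Rightarrow> 'n metric_field \<Rightarrow> bool" where
  "VSI_on U g \<longleftrightarrow> pseudo_riemannian_on U g \<and>
     (\<forall>I\<in>scalar_weyl_invariants g. \<forall>p\<in>U. I p = 0)"

text \<open>Coordinates \<open>1, 2, 3\<close> of \<^typ>\<open>real ^ 3\<close> are \<open>x, y, x~\<close>.\<close>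

definition walker_metric :: "(real ^ 3 \<Rightarrow> real) \<Rightarrow> 3 metric_field" where
  "walker_metric f p = vector [vector [- 2 * f p, 0, 1],
                               vector [0,         1, 0],
                               vector [1,         0, 0]]"

end

theory Submission
  imports Defs
begin

text \<open>
  Give the lower indices \<open>1, 2, 3\<close> (that is \<open>x, y, x~\<close>) the boost weights \<open>1, 0, -1\<close>. Every
  non-zero Christoffel symbol raises the weight by at least \<open>2\<close>, and the only coordinate derivative
  that lowers it, \<open>\<partial>\<^sub>3\<close>, kills all the components, as they depend on \<open>x, y\<close> alone. So the non-zero
  components of \<open>\<nabla>\<^sup>kR\<close> have weight at least \<open>2\<close>. The non-zero entries of the inverse metric have
  weight at most \<open>0\<close>, so a complete contraction only sees components of weight at most \<open>0\<close>.
\<close>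

section \<open>Smooth functions\<close>

lemma partial_eqI: "(f has_derivative D) (at p) \<Longrightarrow> partial i f p = D (axis i 1)"
  unfolding partial_def by (simp add: frechet_derivative_at[symmetric])

lemma has_derivative_cong_open:
  assumes "open U" "p \<in> U" "\<And>q. q \<in> U \<Longrightarrow> f q = g q"
  shows "(f has_derivative D) (at p) \<longleftrightarrow> (g has_derivative D) (at p)"
  using assms has_derivative_transform_within_open[of f D p UNIV U g]
    has_derivative_transform_within_open[of g D p UNIV U f] by auto

lemma partial_cong_open:
  assumes "open U" "p \<in> U" "\<And>q. q \<in> U \<Longrightarrow> f q = g q"
  shows "partial i f p = partial i g p"
  unfolding partial_def frechet_derivative_def
  using has_derivative_cong_open[OF assms] by simp

lemma smooth_onD: "smooth_on U f \<Longrightarrow> p \<in> U \<Longrightarrow> f differentiable (at p)"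
  unfolding smooth_on_def by (metis fold_simps(1))

lemma smooth_on_partial: "smooth_on U f \<Longrightarrow> smooth_on U (partial i f)"
  unfolding smooth_on_def by (metis fold_simps(2))

text \<open>\<open>smooth_on U\<close> is the largest class of functions that are differentiable on
  \<open>U\<close> and closed under \<open>partial\<close>, so smoothness follows from exhibiting
  any class with these two properties.\<close>

lemma smooth_on_coinduct:
  assumes "P f"
    and "\<And>f p. P f \<Longrightarrow> p \<in> U \<Longrightarrow> f differentiable (at p)"
    and "\<And>f i. P f \<Longrightarrow> P (partial i f)"
  shows "smooth_on U f"
proof -
  have "P (fold partial js f)" for js
    using assms(1) by (induction js arbitrary: f) (auto intro: assms(3))
  then show ?thesis
    unfolding smooth_on_def using assms(2) by blast
qed

text \<open>Iterated derivatives of a product are growing sums of products, so the whole algebra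
  generated by the smooth functions serves as the class in \<open>smooth_on_coinduct\<close>. The
  rule \<open>cong\<close> is there because the sum and product rules are available on
  \<open>U\<close> only; elsewhere \<open>partial\<close> may be a junk value.\<close>

inductive smooth_alg :: "(real ^ 'n::finite) set \<Rightarrow> (real ^ 'n \<Rightarrow> real) \<Rightarrow> bool" for U where
  smooth: "smooth_on U f \<Longrightarrow> smooth_alg U f"
| const: "smooth_alg U (\<lambda>p. c)"
| add: "smooth_alg U f \<Longrightarrow> smooth_alg U g \<Longrightarrow> smooth_alg U (\<lambda>p. f p + g p)"
| mult: "smooth_alg U f \<Longrightarrow> smooth_alg U g \<Longrightarrow> smooth_alg U (\<lambda>p. f p * g p)"
| cong: "smooth_alg U f \<Longrightarrow> (\<And>p. p \<in> U \<Longrightarrow> f p = g p) \<Longrightarrow> smooth_alg U g"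

lemma smooth_alg_differentiable:
  assumes "open U" "smooth_alg U f" "p \<in> U"
  shows "f differentiable (at p)"
  using assms(2,3)
proof (induction rule: smooth_alg.induct)
  case (cong f g)
  then show ?case
    unfolding differentiable_def
    using has_derivative_cong_open[OF assms(1) \<open>p \<in> U\<close>, of f g] by blast
qed (auto intro: smooth_onD)

lemma smooth_alg_partial:
  assumes "open U" "smooth_alg U f"
  shows "smooth_alg U (partial i f)"
  using assms(2)
proof (induction rule: smooth_alg.induct)
  case (smooth f)
  then show ?case by (intro smooth_alg.smooth smooth_on_partial)
next
  case (const c)
  have "partial i (\<lambda>p. c) = (\<lambda>p. 0)"
    by (rule ext, rule partial_eqI[where D = "\<lambda>_. 0"]) simp
  then show ?case using smooth_alg.const by metis
next
  case (add f g)
  show ?case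
  proof (rule smooth_alg.cong[OF smooth_alg.add[OF add.IH]])
    fix p assume "p \<in> U"
    then have "(f has_derivative frechet_derivative f (at p)) (at p)"
      "(g has_derivative frechet_derivative g (at p)) (at p)"
      using smooth_alg_differentiable[OF assms(1)] add.hyps frechet_derivative_works by blast+
    from partial_eqI[OF has_derivative_add[OF this], of i]
    show "partial i f p + partial i g p = partial i (\<lambda>p. f p + g p) p"
      by (simp add: partial_def)
  qed
next
  case (mult f g)
  show ?case
  proof (rule smooth_alg.cong[OF smooth_alg.add[OF
          smooth_alg.mult[OF mult.hyps(1) mult.IH(2)] smooth_alg.mult[OF mult.IH(1) mult.hyps(2)]]])
    fix p assume "p \<in> U"
    then have "(f has_derivative frechet_derivative f (at p)) (at p)"
      "(g has_derivative frechet_derivative g (at p)) (at p)"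
      using smooth_alg_differentiable[OF assms(1)] mult.hyps frechet_derivative_works by blast+
    from partial_eqI[OF has_derivative_mult[OF this], of i]
    show "f p * partial i g p + partial i f p * g p = partial i (\<lambda>p. f p * g p) p"
      by (simp add: partial_def)
  qed
next
  case (cong f g)
  show ?case
    by (rule smooth_alg.cong[OF cong.IH]) (rule partial_cong_open[OF assms(1)], auto simp: cong.hyps)
qed

lemma smooth_alg_iff:
  assumes "open U"
  shows "smooth_alg U f \<longleftrightarrow> smooth_on U f"
proof
  assume "smooth_alg U f"
  then show "smooth_on U f"
    by (rule smooth_on_coinduct) (fact smooth_alg_differentiable[OF assms] smooth_alg_partial[OF assms])+
qed (fact smooth_alg.smooth)


section \<open>Smooth functions that do not depend on one coordinate\<close>

text \<open>Any two points of \<open>U\<close> on a common line in direction \<open>k\<close> are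
  compared, even if the segment between them leaves \<open>U\<close>. In general this is more than
  the vanishing of \<open>partial k h\<close> on \<open>U\<close>.\<close>

definition smooth_indep :: "'n::finite \<Rightarrow> (real ^ 'n) set \<Rightarrow> (real ^ 'n \<Rightarrow> real) \<Rightarrow> bool" where
  "smooth_indep k U h \<longleftrightarrow> smooth_on U h \<and>
     (\<forall>p\<in>U. \<forall>q\<in>U. (\<forall>i. i \<noteq> k \<longrightarrow> p $ i = q $ i) \<longrightarrow> h p = h q)"

context
  fixes U :: "(real ^ 'n::finite) set" and k :: 'n
  assumes open_U: "open U"
begin

lemma smooth_indep_const: "smooth_indep k U (\<lambda>p. c)"
  unfolding smooth_indep_def using smooth_alg.const smooth_alg_iff[OF open_U] by blast

lemma smooth_indep_add:
  "smooth_indep k U f \<Longrightarrow> smooth_indep k U g \<Longrightarrow> smooth_indep k U (\<lambda>p. f p + g p)"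
  unfolding smooth_indep_def using smooth_alg.add[of U f g] smooth_alg_iff[OF open_U] by metis

lemma smooth_indep_mult:
  "smooth_indep k U f \<Longrightarrow> smooth_indep k U g \<Longrightarrow> smooth_indep k U (\<lambda>p. f p * g p)"
  unfolding smooth_indep_def using smooth_alg.mult[of U f g] smooth_alg_iff[OF open_U] by metis

lemma smooth_indep_uminus: "smooth_indep k U f \<Longrightarrow> smooth_indep k U (\<lambda>p. - f p)"
  using smooth_indep_mult[OF smooth_indep_const[of "-1"], of f] by simp

lemma smooth_indep_diff:
  "smooth_indep k U f \<Longrightarrow> smooth_indep k U g \<Longrightarrow> smooth_indep k U (\<lambda>p. f p - g p)"
  using smooth_indep_add[OF _ smooth_indep_uminus, of f g] by simp

lemma smooth_indep_divide_const:
  "smooth_indep k U f \<Longrightarrow> smooth_indep k U (\<lambda>p. f p / c)"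
  using smooth_indep_mult[OF _ smooth_indep_const[of "inverse c"], of f]
  by (simp add: divide_inverse)

lemma smooth_indep_sum:
  "(\<And>i. i \<in> I \<Longrightarrow> smooth_indep k U (f i)) \<Longrightarrow> smooth_indep k U (\<lambda>p. \<Sum>i\<in>I. f i p)"
  by (induction I rule: infinite_finite_induct)
    (auto intro: smooth_indep_const smooth_indep_add)

text \<open>Translation by \<open>q - p\<close> moves points in direction \<open>k\<close> only, so
  it does not change \<open>h\<close> wherever a point and its translate both lie in
  \<open>U\<close>. Hence the derivative of \<open>h\<close> at \<open>q\<close> is also its
  derivative at \<open>p\<close>.\<close>

lemma smooth_indep_partial:
  assumes "smooth_indep k U h"
  shows "smooth_indep k U (partial i h)"
proof -
  have "partial i h p = partial i h q"
    if pq: "p \<in> U" "q \<in> U" "\<forall>i. i \<noteq> k \<longrightarrow> p $ i = q $ i" for p q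
  proof -
    define D where "D = frechet_derivative h (at q)"
    have D: "(h has_derivative D) (at q)"
      using assms pq smooth_onD frechet_derivative_works
      unfolding smooth_indep_def D_def by blast
    \<comment> \<open>\<open>U\<close> need not be invariant under the translation; this is a
      neighbourhood of \<open>p\<close> in which the translated points stay in
      \<open>U\<close>.\<close>
    let ?V = "U \<inter> (\<lambda>v. v + (q - p)) -` U"
    have "((\<lambda>v. h (v + (q - p))) has_derivative D) (at p)"
    proof (rule has_derivative_compose[where g = h and g' = D and f' = "\<lambda>x. x", simplified])
      show "((\<lambda>v. v + (q - p)) has_derivative (\<lambda>x. x)) (at p)"
        by (auto intro!: derivative_eq_intros)
    qed (use D in simp)
    moreover have "open ?V"
      by (intro open_Int open_vimage open_U continuous_intros)
    moreover have "h (v + (q - p)) = h v" if "v \<in> ?V" for v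
      using assms that pq(3) unfolding smooth_indep_def by auto
    ultimately have "(h has_derivative D) (at p)"
      using has_derivative_cong_open[of ?V p "\<lambda>v. h (v + (q - p))" h D] pq by simp
    then show ?thesis
      using D partial_eqI by metis
  qed
  then show ?thesis
    using assms smooth_on_partial unfolding smooth_indep_def by blast
qed

text \<open>Along the line through \<open>p\<close> in direction \<open>k\<close>, \<open>h\<close>
  is constant near \<open>p\<close>, so the chain rule and the uniqueness of derivatives force the
  directional derivative to be 0.\<close>

lemma partial_eq_0_if_smooth_indep:
  assumes "smooth_indep k U h" "p \<in> U"
  shows "partial k h p = 0"
proof -
  define D where "D = frechet_derivative h (at p)"
  let ?l = "\<lambda>t::real. p + t *\<^sub>R axis k 1"
  have D: "(h has_derivative D) (at p)"
    using assms smooth_onD frechet_derivative_works unfolding smooth_indep_def D_def by blast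
  have 1: "((\<lambda>t. h (?l t)) has_derivative (\<lambda>t. D (t *\<^sub>R axis k 1))) (at 0)"
  proof (rule has_derivative_compose[where g = h and g' = D])
    show "(?l has_derivative (\<lambda>t. t *\<^sub>R axis k 1)) (at 0)"
      by (auto intro!: derivative_eq_intros)
  qed (use D in simp)
  have "open (?l -` U)"
    by (intro open_vimage open_U continuous_intros)
  moreover have "h (?l t) = h p" if "t \<in> ?l -` U" for t
  proof -
    have "\<forall>i. i \<noteq> k \<longrightarrow> ?l t $ i = p $ i"
      by (simp add: axis_def)
    then show ?thesis
      using assms that unfolding smooth_indep_def vimage_def by blast
  qed
  ultimately have "((\<lambda>t. h p) has_derivative (\<lambda>t. D (t *\<^sub>R axis k 1))) (at 0)"
    using has_derivative_cong_open[of "?l -` U" 0 "\<lambda>t. h (?l t)" "\<lambda>t. h p"] 1 assms(2) by simp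
  then have "(\<lambda>t. D (t *\<^sub>R axis k 1)) = (\<lambda>t. 0)"
    by (rule has_derivative_unique) simp
  then have "D (1 *\<^sub>R axis k 1) = 0" by metis
  then show ?thesis using partial_eqI[OF D] by simp
qed

end


section \<open>The Walker metric\<close>

lemma walker_metric_nth:
  "walker_metric f p $ i $ j =
     (if i = 1 \<and> j = 1 then - 2 * f p
      else if (i, j) \<in> {(1, 3), (2, 2), (3, 1)} then 1 else 0)"
  using exhaust_3[of i] exhaust_3[of j] by (auto simp: walker_metric_def)

definition walker_inverse :: "(real ^ 3 \<Rightarrow> real) \<Rightarrow> 3 metric_field" where
  "walker_inverse f p = vector [vector [0, 0, 1],
                                vector [0, 1, 0],
                                vector [1, 0, 2 * f p]]"

lemma walker_inverse_nth:
  "walker_inverse f p $ i $ j =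
     (if i = 3 \<and> j = 3 then 2 * f p
      else if (i, j) \<in> {(1, 3), (2, 2), (3, 1)} then 1 else 0)"
  using exhaust_3[of i] exhaust_3[of j] by (auto simp: walker_inverse_def)

lemma walker_metric_mult_inverse:
  "walker_metric f p ** walker_inverse f p = mat 1"
  "walker_inverse f p ** walker_metric f p = mat 1"
  by (simp_all add: vec_eq_iff forall_3 matrix_matrix_mult_def sum_3 mat_def
      walker_metric_def walker_inverse_def)

lemma invertible_walker_metric: "invertible (walker_metric f p)"
  unfolding invertible_def using walker_metric_mult_inverse by blast

lemma matrix_inv_walker_metric: "matrix_inv (walker_metric f p) = walker_inverse f p"
proof -
  have "walker_metric f p ** matrix_inv (walker_metric f p) = mat 1"
    unfolding matrix_inv_def
    by (rule someI2[where a = "walker_inverse f p"]) (auto simp: walker_metric_mult_inverse)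
  then show ?thesis
    using walker_metric_mult_inverse(2)[of f p]
    by (metis matrix_mul_assoc matrix_mul_lid matrix_mul_rid)
qed

lemma walker_metric_frame:
  "\<exists>(e :: 3 \<Rightarrow> real ^ 3) i0. \<forall>i j. e i \<bullet> (walker_metric f p *v e j) =
     (if i \<noteq> j then 0 else if i = i0 then - 1 else 1)"
proof -
  \<comment> \<open>The vector \<open>(1, 0, c)\<close> has square \<open>- 2 * f p + 2 * c\<close>,
    which is -1 and 1 for \<open>c = f p - 1 / 2\<close> and \<open>c = f p + 1 / 2\<close>. These
    two vectors are orthogonal because their values of \<open>c\<close> add up to
    \<open>2 * f p\<close>.\<close>
  define e :: "3 \<Rightarrow> real ^ 3" where
    "e i = (if i = 1 then vector [1, 0, f p - 1 / 2]
            else if i = 2 then vector [0, 1, 0] else vector [1, 0, f p + 1 / 2])" for i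
  have "\<forall>i j. e i \<bullet> (walker_metric f p *v e j) = (if i \<noteq> j then 0 else if i = 1 then - 1 else 1)"
    by (simp add: forall_3 e_def inner_vec_def sum_3 matrix_vector_mult_def walker_metric_def
        algebra_simps)
  then show ?thesis by blast
qed

section \<open>Boost weights of indices and of the metric entries\<close>

definition boost_weight :: "3 \<Rightarrow> int" where
  "boost_weight i = (if i = 1 then 1 else if i = 2 then 0 else - 1)"

abbreviation list_weight :: "3 list \<Rightarrow> int" where
  "list_weight is \<equiv> (\<Sum>i\<leftarrow>is. boost_weight i)"

text \<open>The constant non-zero entries have weight 0. The function \<open>f\<close> sits at the
  entry (1, 1) of weight 2, but in the inverse at (3, 3) of weight -2, which explains the opposite
  inequality in \<open>walker_inverse_weight\<close>.\<close>

lemma walker_metric_weight: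
  "walker_metric f p $ i $ j \<noteq> 0 \<Longrightarrow> boost_weight i + boost_weight j \<ge> 0"
  by (auto simp: walker_metric_nth boost_weight_def split: if_splits)

lemma walker_inverse_weight:
  "walker_inverse f p $ i $ j \<noteq> 0 \<Longrightarrow> boost_weight i + boost_weight j \<le> 0"
  by (auto simp: walker_inverse_nth boost_weight_def split: if_splits)

lemma list_weight_update:
  "a < length is \<Longrightarrow> list_weight (is[a := l]) = list_weight is - boost_weight (is ! a) + boost_weight l"
  by (induction "is" arbitrary: a) (auto split: nat.splits)

locale walker =
  fixes U :: "(real ^ 3) set" and f :: "real ^ 3 \<Rightarrow> real"
  assumes open_U: "open U" and f: "smooth_indep 3 U f"
begin

abbreviation g :: "3 metric_field" where "g \<equiv> walker_metric f"

lemmas closure = smooth_indep_const[OF open_U] smooth_indep_add[OF open_U]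
  smooth_indep_mult[OF open_U] smooth_indep_uminus[OF open_U] smooth_indep_diff[OF open_U]
  smooth_indep_divide_const[OF open_U] smooth_indep_sum[OF open_U]
  smooth_indep_partial[OF open_U]

lemma smooth_indep_metric: "smooth_indep 3 U (\<lambda>p. g p $ i $ j)"
  unfolding walker_metric_nth by (cases "i = 1 \<and> j = 1") (auto intro!: closure f)

lemma smooth_indep_inverse: "smooth_indep 3 U (\<lambda>p. matrix_inv (g p) $ i $ j)"
  unfolding matrix_inv_walker_metric walker_inverse_nth
  by (cases "i = 3 \<and> j = 3") (auto intro!: closure f)

lemma lorentzian: "lorentzian_on U g"
proof -
  have "transpose (g p) = g p" for p
    by (auto simp: vec_eq_iff transpose_def walker_metric_nth)
  then show ?thesis
    unfolding lorentzian_on_def pseudo_riemannian_on_def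
    using smooth_indep_metric invertible_walker_metric walker_metric_frame
    by (auto simp: smooth_indep_def)
qed

text \<open>Since \<open>partial 3 h\<close> vanishes on \<open>U\<close>, only directions of weight
  1 or 0 remain. A non-zero derivative at \<open>p\<close> allows \<open>h p = 0\<close>, so the
  second conclusion only provides some point \<open>q\<close>; this suffices because the weight
  bounds hold at all points of \<open>U\<close>.\<close>

lemma partial_nonzeroD:
  assumes "smooth_indep 3 U h" "p \<in> U" "partial i h p \<noteq> 0"
  shows "boost_weight i \<ge> 0" "\<exists>q\<in>U. h q \<noteq> 0"
proof -
  have "i \<noteq> 3"
    using assms partial_eq_0_if_smooth_indep[OF open_U] by blast
  then show "boost_weight i \<ge> 0"
    using exhaust_3[of i] by (auto simp: boost_weight_def)
  show "\<exists>q\<in>U. h q \<noteq> 0"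
  proof (rule ccontr)
    assume "\<not> (\<exists>q\<in>U. h q \<noteq> 0)"
    then have "partial i h p = partial i (\<lambda>_. 0) p"
      by (intro partial_cong_open[OF open_U assms(2)]) auto
    also have "\<dots> = 0"
      by (rule partial_eqI[where D = "\<lambda>_. 0"]) simp
    finally show False using assms(3) by simp
  qed
qed

section \<open>Weights of the Christoffel symbols and the curvature\<close>

lemma smooth_indep_christoffel: "smooth_indep 3 U (christoffel g l i j)"
  unfolding christoffel_def[abs_def] by (intro closure smooth_indep_metric smooth_indep_inverse)

lemma partial_metric_nonzeroD:
  assumes "p \<in> U" "partial m (\<lambda>q. g q $ i $ j) p \<noteq> 0"
  shows "i = 1 \<and> j = 1 \<and> m \<noteq> 3"
proof -
  have "m \<noteq> 3"
    using partial_eq_0_if_smooth_indep[OF open_U smooth_indep_metric] assms by blast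
  moreover have "i = 1 \<and> j = 1"
  proof (rule ccontr)
    assume "\<not> (i = 1 \<and> j = 1)"
    then have "(\<lambda>q. g q $ i $ j) = (\<lambda>q. if (i, j) \<in> {(1, 3), (2, 2), (3, 1)} then 1 else 0)"
      by (auto simp: walker_metric_nth)
    then have "partial m (\<lambda>q. g q $ i $ j) p = 0"
      by (simp only:, intro partial_eqI[where D = "\<lambda>_. 0"]) simp
    then show False using assms by simp
  qed
  ultimately show ?thesis by simp
qed

text \<open>A non-zero derivative of a metric entry carries the index 1 twice and a third index of
  weight at least 0, so its total weight is at least 2. The inverse metric entry trades
  \<open>m\<close> for the upper index \<open>l\<close>, whose weight is at most minus that of
  \<open>m\<close>; upper indices therefore count negatively.\<close>

lemma christoffel_weight:
  assumes "p \<in> U" "christoffel g l i j p \<noteq> 0"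
  shows "boost_weight i + boost_weight j \<ge> boost_weight l + 2"
proof -
  obtain m where inv: "walker_inverse f p $ l $ m \<noteq> 0"
    and "partial i (\<lambda>q. g q $ j $ m) p + partial j (\<lambda>q. g q $ i $ m) p
      - partial m (\<lambda>q. g q $ i $ j) p \<noteq> 0"
    using assms(2) unfolding christoffel_def matrix_inv_walker_metric
    by (metis (no_types, lifting) div_0 mult_eq_0_iff sum.neutral)
  then have "partial i (\<lambda>q. g q $ j $ m) p \<noteq> 0 \<or> partial j (\<lambda>q. g q $ i $ m) p \<noteq> 0
      \<or> partial m (\<lambda>q. g q $ i $ j) p \<noteq> 0"
    by auto
  then have "(j = 1 \<and> m = 1 \<and> i \<noteq> 3) \<or> (i = 1 \<and> m = 1 \<and> j \<noteq> 3) \<or> (i = 1 \<and> j = 1 \<and> m \<noteq> 3)"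
    using partial_metric_nonzeroD[OF assms(1)] by blast
  then have "boost_weight i + boost_weight j + boost_weight m \<ge> 2"
    using exhaust_3[of i] exhaust_3[of j] exhaust_3[of m] by (auto simp: boost_weight_def)
  then show ?thesis
    using walker_inverse_weight[OF inv] by linarith
qed

lemma smooth_indep_curvature_op: "smooth_indep 3 U (curvature_op g i j k l)"
  unfolding curvature_op_def[abs_def] by (intro closure smooth_indep_christoffel)

lemma partial_christoffel_weight:
  assumes "p \<in> U" "partial i (christoffel g l j k) p \<noteq> 0"
  shows "boost_weight i + boost_weight j + boost_weight k \<ge> boost_weight l + 2"
  using partial_nonzeroD[OF smooth_indep_christoffel assms] christoffel_weight by fastforce

text \<open>The derivative terms inherit the bound from the Christoffel symbols. In the quadratic
  terms the summation index \<open>m\<close> is once upper and once lower, so its weight cancels and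
  the excess is even 4.\<close>

lemma curvature_op_weight:
  assumes "p \<in> U" "curvature_op g i j k l p \<noteq> 0"
  shows "boost_weight i + boost_weight j + boost_weight k \<ge> boost_weight l + 2"
proof (rule ccontr)
  assume neg: "\<not> ?thesis"
  have "partial i (christoffel g l j k) p = 0" "partial j (christoffel g l i k) p = 0"
    using neg partial_christoffel_weight[OF assms(1)] by fastforce+
  moreover have "christoffel g l i m p * christoffel g m j k p = 0"
    "christoffel g l j m p * christoffel g m i k p = 0" for m
    using neg christoffel_weight[OF assms(1), of l i m] christoffel_weight[OF assms(1), of m j k]
      christoffel_weight[OF assms(1), of l j m] christoffel_weight[OF assms(1), of m i k]
    unfolding mult_eq_0_iff by linarith+
  ultimately show False
    using assms(2) unfolding curvature_op_def by (simp only: diff_self add_0 sum.neutral_const)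
qed

text \<open>No length condition is imposed: on a list that is too short, \<open>!\<close> still
  yields some fixed index. This gives the hypothesis for all lists in
  \<open>smooth_indep_cov_deriv\<close>.\<close>

lemma smooth_indep_curvature: "smooth_indep 3 U (curvature g is)"
  unfolding curvature_def[abs_def]
  by (intro closure smooth_indep_curvature_op smooth_indep_metric)

lemma curvature_weight:
  assumes "p \<in> U" "length is = 4" "curvature g is p \<noteq> 0"
  shows "list_weight is \<ge> 2"
proof -
  obtain i j k l where "is": "is = [i, j, k, l]"
    using assms(2) by (auto simp: numeral_eq_Suc length_Suc_conv)
  obtain m where "curvature_op g i j k m p \<noteq> 0" "g p $ m $ l \<noteq> 0"
    using assms(3) unfolding curvature_def "is"
    by (auto elim!: sum.not_neutral_contains_not_neutral)
  \<comment> \<open>Lowering the upper index \<open>m\<close> to \<open>l\<close> keeps the excess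
    2, as the metric entry has weight at least 0.\<close>
  then show ?thesis
    using curvature_op_weight[OF assms(1), of i j k m] walker_metric_weight[of f p m l]
    by (simp add: "is")
qed

section \<open>Weights of the covariant derivatives\<close>

lemma smooth_indep_cov_deriv:
  assumes "\<And>is. smooth_indep 3 U (T is)"
  shows "smooth_indep 3 U (cov_deriv g T is)"
  unfolding cov_deriv_def[abs_def] Let_def by (intro closure assms smooth_indep_christoffel)

text \<open>In the derivative term the new index \<open>m\<close> has weight at least 0. In a
  correction term, replacing \<open>js ! a\<close> by \<open>l\<close> is compensated by the
  Christoffel symbol with 2 to spare. The bound \<open>c\<close> is assumed at all points of
  \<open>U\<close>, because the derivative term refers to a point other than
  \<open>p\<close>.\<close>

lemma cov_deriv_weight:
  assumes T: "\<And>is. smooth_indep 3 U (T is)"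
    and weight: "\<And>is p. p \<in> U \<Longrightarrow> length is = r \<Longrightarrow> T is p \<noteq> 0 \<Longrightarrow> list_weight is \<ge> c"
    and p: "p \<in> U" and len: "length is = Suc r" and nz: "cov_deriv g T is p \<noteq> 0"
  shows "list_weight is \<ge> c"
proof -
  obtain js m where "is": "is = js @ [m]" and js: "length js = r"
    using len by (metis length_append_singleton length_Suc_conv_rev nat.inject)
  have "partial m (T js) p \<noteq> 0 \<or>
    (\<exists>a<r. \<exists>l. christoffel g l m (js ! a) p * T (js[a := l]) p \<noteq> 0)"
  proof (rule ccontr)
    assume "\<not> ?thesis"
    then have "partial m (T js) p = 0"
      "(\<Sum>a<r. \<Sum>l\<in>UNIV. christoffel g l m (js ! a) p * T (js[a := l]) p) = 0"
      by (auto intro!: sum.neutral)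
    then show False using nz by (simp add: cov_deriv_def "is" js)
  qed
  then show ?thesis
  proof (elim disjE exE conjE)
    assume "partial m (T js) p \<noteq> 0"
    from partial_nonzeroD[OF T p this] weight[OF _ js] show ?thesis
      by (force simp: "is")
  next
    fix a l assume a: "a < r" and "christoffel g l m (js ! a) p * T (js[a := l]) p \<noteq> 0"
    then have "boost_weight m + boost_weight (js ! a) \<ge> boost_weight l + 2"
      "list_weight (js[a := l]) \<ge> c"
      using christoffel_weight[OF p, of l m "js ! a"] weight[OF p, of "js[a := l]"] js by auto
    then show ?thesis
      using a js by (simp add: "is" list_weight_update)
  qed
qed

text \<open>Both claims are proved in one induction: the weight bound for the next derivative uses
  that the current one is independent of the third coordinate.\<close>

lemma nabla_curvature_weight:
  "smooth_indep 3 U (nabla_curvature g k is)"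
  "p \<in> U \<Longrightarrow> length is = 4 + k \<Longrightarrow> nabla_curvature g k is p \<noteq> 0 \<Longrightarrow> list_weight is \<ge> 2"
proof (induction k arbitrary: "is" p)
  case 0
  { case 1 show ?case by (simp add: nabla_curvature_def smooth_indep_curvature)
  next
    case 2 then show ?case using curvature_weight by (simp add: nabla_curvature_def) }
next
  case (Suc k)
  have eq: "nabla_curvature g (Suc k) = cov_deriv g (nabla_curvature g k)"
    by (simp add: nabla_curvature_def)
  { case 1 show ?case unfolding eq by (rule smooth_indep_cov_deriv[OF Suc(1)])
  next
    case 2 show ?case
      by (rule cov_deriv_weight[where T = "nabla_curvature g k" and r = "4 + k" and p = p])
        (use 2 Suc eq in auto) }
qed

section \<open>Tensor products and complete contractions\<close>

lemma curvature_product_weight: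
  assumes "p \<in> U" "length is = product_rank ks" "curvature_product g ks is p \<noteq> 0"
  shows "list_weight is \<ge> 2 * int (length ks)"
  using assms(2,3)
proof (induction ks arbitrary: "is")
  case Nil
  then show ?case by (simp add: product_rank_def)
next
  case (Cons k ks)
  let ?t = "take (4 + k) is" and ?d = "drop (4 + k) is"
  have "length ?t = 4 + k" "length ?d = product_rank ks"
    using Cons.prems(1) by (auto simp: product_rank_def)
  moreover have "nabla_curvature g k ?t p \<noteq> 0" "curvature_product g ks ?d p \<noteq> 0"
    using Cons.prems(2) by simp_all
  ultimately have "list_weight ?t \<ge> 2" "list_weight ?d \<ge> 2 * int (length ks)"
    using nabla_curvature_weight(2)[OF assms(1)] Cons.IH by auto
  \<comment> \<open>Weights add under concatenation, so every factor contributes its own 2. The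
    empty product gets only 0, hence the later condition \<open>ks \<noteq> []\<close>.\<close>
  moreover have "list_weight is = list_weight ?t + list_weight ?d"
    by (metis append_take_drop_id map_append sum_list_append)
  ultimately show ?case by simp
qed

text \<open>Every position occurs exactly once among the first and second members of the pairs, so
  the sum over positions can be regrouped pair by pair.\<close>

lemma list_weight_complete_pairing:
  assumes "complete_pairing r ps" "length is = r"
  shows "list_weight is = (\<Sum>(a, b)\<leftarrow>ps. boost_weight (is ! a) + boost_weight (is ! b))"
proof -
  let ?w = "\<lambda>a. boost_weight (is ! a)" and ?qs = "map fst ps @ map snd ps"
  have "list_weight is = (\<Sum>a<r. ?w a)"
    using assms(2) by (simp add: sum_list_sum_nth atLeast0LessThan)
  also have "\<dots> = (\<Sum>a\<in>set ?qs. ?w a)"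
    using assms(1) unfolding complete_pairing_def by simp
  also have "\<dots> = (\<Sum>a\<leftarrow>?qs. ?w a)"
    using assms(1) unfolding complete_pairing_def by (intro sum_list_distinct_conv_sum_set[symmetric]) simp
  also have "\<dots> = (\<Sum>(a, b)\<leftarrow>ps. ?w a + ?w b)"
    by (induction ps) auto
  finally show ?thesis .
qed

text \<open>In a non-zero summand all inverse metric factors are non-zero, so each pair has weight
  at most 0. The total weight would then be at most 0, against the positivity assumed for
  \<open>T\<close>.\<close>

lemma contract_eq_0:
  assumes "complete_pairing r ps"
    and "\<And>is. length is = r \<Longrightarrow> T is p \<noteq> 0 \<Longrightarrow> list_weight is > 0"
  shows "contract g r ps T p = 0"
  unfolding contract_def
proof (rule sum.neutral, rule ballI, rule ccontr)
  fix "is" :: "3 list"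
  assume "is \<in> {is. length is = r}"
    and nz: "(\<Prod>(a, b)\<leftarrow>ps. matrix_inv (g p) $ (is ! a) $ (is ! b)) * T is p \<noteq> 0"
  then have len: "length is = r" by simp
  have "boost_weight (is ! a) + boost_weight (is ! b) \<le> 0" if "(a, b) \<in> set ps" for a b
    using nz that by (intro walker_inverse_weight[of f p])
      (force simp: prod_list_zero_iff matrix_inv_walker_metric)
  then have "(\<Sum>(a, b)\<leftarrow>ps. boost_weight (is ! a) + boost_weight (is ! b)) \<le> 0"
    by (intro sum_list_nonpos) auto
  then show False
    using assms(2)[OF len] list_weight_complete_pairing[OF assms(1) len] nz by simp
qed

lemma VSI: "VSI_on U g"
proof -
  have "contract g (product_rank ks) ps (curvature_product g ks) p = 0"
    if "p \<in> U" "ks \<noteq> []" "complete_pairing (product_rank ks) ps" for ks ps p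
  proof (rule contract_eq_0[OF that(3)])
    fix "is" :: "3 list"
    assume "length is = product_rank ks" "curvature_product g ks is p \<noteq> 0"
    from curvature_product_weight[OF that(1) this] show "list_weight is > 0"
      using that(2) by (cases ks) auto
  qed
  then show ?thesis
    using lorentzian unfolding VSI_on_def lorentzian_on_def scalar_weyl_invariants_def by blast
qed

end

theorem theorem1p14:
  fixes U :: "(real ^ 3) set" and f :: "real ^ 3 \<Rightarrow> real"
  assumes "open U" and "connected U"
    and "smooth_on U f"
    and "\<forall>p\<in>U. \<forall>q\<in>U. p $ 1 = q $ 1 \<and> p $ 2 = q $ 2 \<longrightarrow> f p = f q"
  shows "lorentzian_on U (walker_metric f) \<and> VSI_on U (walker_metric f)"
proof -
  \<comment> \<open>Agreement in all coordinates other than 3 must be instantiated at 1 and 2; in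
    the finite type \<open>3\<close>, that these differ from 3 is a fact about residues.\<close>
  have "(1::3) \<noteq> 3" "(2::3) \<noteq> 3" by simp_all
  then have "smooth_indep 3 U f"
    unfolding smooth_indep_def using assms(3,4) by blast
  with assms(1) have "walker U f" by (rule walker.intro)
  then show ?thesis
    using walker.lorentzian walker.VSI by blast
qed

end
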